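(* Let $2\leq r<s$ be integers. If $\frac{s+1}{2}\geq r$, then $$n_{bb}(r,s;3)=2(s-r+1).$$ If $r>\frac{s+1}{2}$, then $$n_{bb}(r,s;3)= \begin{cases} s+1, & \text{if } s\equiv 3\pmod 4, \text{ or } s\equiv 1\pmod 4 \text{ and } r \text{ is odd},\\ s+2, & \text{if } s\equiv 2\pmod 4, \text{ or } s\equiv 0\pmod 4 \text{ and } r \text{ is even},\\ s+3, & \text{if } s\equiv 1\pmod 4 \text{ and } r \text{ is even},\\ s+4, & \text{if } s\equiv 0\pmod 4 \text{ and } r \text{ is odd}. \end{cases}$$
   Context: Graphs are finite and simple. The girth of a graph is the length of its shortest cycle; the order of a graph is its number of vertices. For integers $1\leq r\leq s$ and $g\geq 3$, an $(r,s;g)$-balanced biregular graph (for short, $(r,s;g)$-babi-graph) is a graph of girth $g$ whose set of vertex degrees equals $\{r,s\}$ and in which the number of vertices of degree $r$ equals the number of vertices of degree $s$. $n_{bb}(r,s;g)$ denotes the minimum order of an $(r,s;g)$-babi-graph. *)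

theory Defs
  imports "Graph_Theory.Graph_Theory" "HOL-Library.Extended_Nat"
begin

text \<open>
  A finite simple graph is a \<^locale>\<open>pair_graph\<close>: a finite symmetric loop-free digraph whose
  arcs are pairs of vertices. The edge between u and v is represented by the two arcs (u, v) and
  (v, u), so the degree of a vertex is its out-degree.
\<close>

abbreviation degree :: "'a pair_pre_digraph \<Rightarrow> 'a \<Rightarrow> nat" where
  "degree G v \<equiv> out_degree (with_proj G) v"

text \<open>
  The library notion of a (directed) cycle also covers the closed walk of length 2 that traverses
  an edge back and forth. Requiring length at least 3 leaves exactly the cycles of the undirected
  graph. The girth of an acyclic graph is infinite.
\<close>

definition girth :: "'a pair_pre_digraph \<Rightarrow> enat" where
  "girth G = (INF p \<in> {p. pre_digraph.cycle (with_proj G) p \<and> 3 \<le> length p}. enat (length p))"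

definition babi_graph :: "nat \<Rightarrow> nat \<Rightarrow> nat \<Rightarrow> 'a pair_pre_digraph \<Rightarrow> bool" where
  "babi_graph r s g G \<longleftrightarrow>
     pair_graph G \<and>
     girth G = enat g \<and>
     degree G ` pverts G = {r, s} \<and>
     card {v \<in> pverts G. degree G v = r} = card {v \<in> pverts G. degree G v = s}"

text \<open>
  Every finite graph is isomorphic to one whose vertices are natural numbers, so it is enough to
  minimise over those. The infimum in \<^typ>\<open>enat\<close> is infinite if there is no such graph;
  a finite value is therefore always attained.
\<close>

definition n_bb :: "nat \<Rightarrow> nat \<Rightarrow> nat \<Rightarrow> enat" where
  "n_bb r s g = (INF G \<in> {G :: nat pair_pre_digraph. babi_graph r s g G}. enat (card (pverts G)))"

end

theory Submission
  imports Defs "HOL-Number_Theory.Cong"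
begin

text \<open>
  Let G be a babi-graph of order 2 m, let A be its vertices of degree r and B those of degree s.
  Three conditions on m are forced. A degree is less than the order, so s < 2 m. The degree sum
  m (r + s) is even. A vertex of B has at most m - 1 neighbours in B, so at least s + 1 - m in A,
  and comparing the number of edges between A and B seen from both sides gives s + 1 - m \<le> r
  (lemma \<open>babi_graph_order\<close>).

  Conversely, such an m is half the order of an (r, s; 3)-babi-graph, at least when m < s or
  m < 2 r, which is true of every value that the theorem claims. Split the
  vertices into two halves of size m, put a p-regular graph on one half, a q-regular graph on the
  other, and a t-regular bipartite graph between them. All degrees are then s in the first
  half and r in the second if p = s - t and q = r - t. Regular graphs on m vertices exist whenever
  the degree is less than m and the degree sum is even; circulants are examples (lemma
  \<open>ex_regular_relation\<close>). The three conditions on m are what makes a choice of t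
  possible (lemma \<open>ex_crossing_degree\<close>). The girth is 3 because two adjacent
  vertices of the first half have a common neighbour as soon as 2 p > m or 2 t > m.

  So the minimum order is twice the least m that satisfies the three conditions (lemma
  \<open>n_bb_eqI\<close>). If (s + 1) / 2 \<ge> r, the binding condition is s + 1 - m \<le> r;
  otherwise it is s < 2 m, and the residue of s modulo 4 and the parity of r tell by how much the
  parity condition pushes m up.
\<close>

section \<open>Degrees and girth in terms of neighbourhoods\<close>

lemma degree_eq_card_Image: "degree G v = card (parcs G `` {v})"
proof -
  have "out_arcs (with_proj G) v = Pair v ` (parcs G `` {v})"
    by (auto simp: out_arcs_def)
  then show ?thesis
    by (simp add: out_degree_def card_image inj_on_def)
qed

lemma girth_eq_3I:
  assumes "pair_graph G" and "(a, b) \<in> parcs G" and "(b, c) \<in> parcs G" and "(a, c) \<in> parcs G"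
  shows "girth G = 3"
proof -
  interpret pair_graph G by fact
  have ca: "(c, a) \<in> parcs G"
    using pair_sym_arcs assms(4) by (auto simp: symmetric_def dest: symD)
  have "a \<noteq> b" "b \<noteq> c" "a \<noteq> c"
    using assms(2-4) pair_no_loops by force+
  moreover have "a \<in> pverts G"
    using assms(2) by (rule in_arcsD1)
  ultimately have "pre_digraph.cycle (with_proj G) [(a, b), (b, c), (c, a)]"
    using assms(2,3) ca
    by (auto simp: pre_digraph.cycle_def pre_digraph.awalk_def awalk_verts_with_proj_eq
        cas_with_proj_eq intro!: exI[of _ a])
  then have "girth G \<le> enat (length [(a, b), (b, c), (c, a)])"
    unfolding girth_def by (intro INF_lower) auto
  moreover have "enat 3 \<le> girth G"
    unfolding girth_def by (intro INF_greatest) auto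
  ultimately show ?thesis
    by (simp add: numeral_eq_enat numeral_3_eq_3)
qed

section \<open>Conditions on the order of a babi-graph\<close>

text \<open>The swap of coordinates matches the pairs below the diagonal with those above it.\<close>

lemma even_card_symmetric:
  fixes E :: "'a :: linorder rel"
  assumes "finite E" and "sym E" and "irrefl E"
  shows "even (card E)"
proof -
  define L where "L = {e \<in> E. fst e < snd e}"
  have "E = L \<union> prod.swap ` L"
  proof (rule set_eqI)
    fix e :: "'a \<times> 'a"
    obtain u v where e: "e = (u, v)" by fastforce
    have "(u, v) \<in> prod.swap ` L \<longleftrightarrow> (v, u) \<in> L"
      by (force simp: image_iff)
    moreover have "(u, v) \<in> E \<longleftrightarrow> (v, u) \<in> E"
      using assms(2) by (auto dest: symD)
    moreover have "(u, v) \<in> E \<Longrightarrow> u \<noteq> v"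
      using assms(3) by (auto simp: irrefl_def)
    ultimately show "e \<in> E \<longleftrightarrow> e \<in> L \<union> prod.swap ` L"
      unfolding e by (auto simp: L_def)
  qed
  moreover have "L \<inter> prod.swap ` L = {}"
    by (auto simp: L_def)
  moreover have "finite L"
    using assms(1) by (simp add: L_def)
  moreover have "card (prod.swap ` L) = card L"
    by (simp add: card_image)
  ultimately have "card E = 2 * card L"
    by (metis card_Un_disjoint finite_imageI mult_2)
  then show ?thesis by simp
qed

lemma even_sum_card_Image:
  fixes E :: "'a :: linorder rel"
  assumes "finite V" and "E \<subseteq> V \<times> V" and "sym E" and "irrefl E"
  shows "even (\<Sum>v\<in>V. card (E `` {v}))"
proof -
  have "E = Sigma V (\<lambda>v. E `` {v})"
    using assms(2) by auto
  moreover have "finite E"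
    using assms(1,2) by (metis finite_SigmaI finite_subset)
  moreover have "card (Sigma V (\<lambda>v. E `` {v})) = (\<Sum>v\<in>V. card (E `` {v}))"
    using assms(1,2) by (intro card_SigmaI) (auto intro: finite_subset[of _ V])
  ultimately show ?thesis
    using even_card_symmetric[OF _ assms(3,4)] by metis
qed

text \<open>Both sides count the edges between the two sets.\<close>

lemma sum_card_Image_Int_swap:
  assumes "finite A" and "finite B" and "sym E"
  shows "(\<Sum>a\<in>A. card (E `` {a} \<inter> B)) = (\<Sum>b\<in>B. card (E `` {b} \<inter> A))"
proof -
  have "(\<Sum>a\<in>A. card {b\<in>B. (a, b) \<in> E}) = (\<Sum>b\<in>B. card {a\<in>A. (a, b) \<in> E})"
    using assms(1,2) by (intro sum_multicount_gen) auto
  moreover have "E `` {a} \<inter> B = {b\<in>B. (a, b) \<in> E}" for a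
    by auto
  moreover have "E `` {b} \<inter> A = {a\<in>A. (a, b) \<in> E}" for b
    using assms(3) by (auto dest: symD)
  ultimately show ?thesis by simp
qed

lemma babi_graph_order:
  fixes G :: "'a :: linorder pair_pre_digraph"
  assumes "babi_graph r s g G" and "r < s"
  obtains m where "card (pverts G) = 2 * m" and "s < 2 * m" and "s < r + m"
    and "even (m * (r + s))"
proof -
  interpret pair_graph G
    using assms(1) by (simp add: babi_graph_def)
  define V where "V = pverts G"
  define E where "E = parcs G"
  define A where "A = {v \<in> V. degree G v = r}"
  define B where "B = {v \<in> V. degree G v = s}"
  define m where "m = card B"
  have fin: "finite V" "finite A" "finite B"
    by (simp_all add: V_def A_def B_def)
  have E: "E \<subseteq> V \<times> V" "sym E" "irrefl E"
    using pair_sym_arcs in_arcsD1 in_arcsD2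
    by (auto simp: E_def V_def symmetric_def irrefl_def dest: pair_no_loops)
  have degs: "degree G ` V = {r, s}" and mA: "card A = m"
    using assms(1) by (auto simp: babi_graph_def V_def A_def B_def m_def)
  have V: "V = A \<union> B" and disj: "A \<inter> B = {}"
    using degs assms(2) by (auto simp: A_def B_def)
  have dA: "card (E `` {a}) = r" if "a \<in> A" for a
    using that by (simp add: A_def E_def degree_eq_card_Image)
  have dB: "card (E `` {b}) = s" if "b \<in> B" for b
    using that by (simp add: B_def E_def degree_eq_card_Image)
  have nbs: "E `` {v} \<subseteq> V - {v}" for v
    using E by (auto simp: irrefl_def)
  have card_V: "card V = 2 * m"
    using fin disj mA by (simp add: V card_Un_disjoint m_def)
  obtain b where b: "b \<in> B"
    using degs by (force simp: B_def)
  have m: "m > 0"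
    using b fin by (auto simp: m_def card_gt_0_iff)
  have "s \<le> card (V - {b})"
    using card_mono[OF _ nbs[of b]] fin dB[OF b] by simp
  also have "\<dots> = 2 * m - 1"
    using b by (simp add: V card_V[unfolded V])
  finally have "s < 2 * m"
    using m by simp
  moreover have "even (m * (r + s))"
  proof -
    have "(\<Sum>v\<in>V. card (E `` {v})) = m * r + m * s"
      unfolding V using fin disj mA
      by (subst sum.union_disjoint) (simp_all add: dA dB m_def)
    then show ?thesis
      using even_sum_card_Image[OF fin(1) E] by (simp add: distrib_left)
  qed
  moreover have "s < r + m"
  proof -
    have inside: "s \<le> card (E `` {b} \<inter> A) + (m - 1)" if "b \<in> B" for b
    proof -
      have "E `` {b} = E `` {b} \<inter> A \<union> E `` {b} \<inter> B"
        using nbs[of b] V by auto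
      then have "s \<le> card (E `` {b} \<inter> A) + card (E `` {b} \<inter> B)"
        by (metis card_Un_le dB that)
      moreover have "card (E `` {b} \<inter> B) \<le> card (B - {b})"
        using fin nbs[of b] by (intro card_mono) auto
      ultimately show ?thesis
        using that by (simp add: m_def)
    qed
    have "m * s \<le> (\<Sum>b\<in>B. card (E `` {b} \<inter> A) + (m - 1))"
      using sum_mono[of B "\<lambda>_. s", OF inside] by (simp add: m_def)
    also have "\<dots> = (\<Sum>a\<in>A. card (E `` {a} \<inter> B)) + m * (m - 1)"
      using sum_card_Image_Int_swap[OF fin(2,3) E(2)] by (simp add: sum.distrib m_def)
    also have "(\<Sum>a\<in>A. card (E `` {a} \<inter> B)) \<le> (\<Sum>a\<in>A. r)"
    proof (rule sum_mono)
      fix a assume "a \<in> A"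
      moreover have "finite (E `` {a})"
        using nbs[of a] fin by (auto intro: finite_subset)
      ultimately show "card (E `` {a} \<inter> B) \<le> r"
        using dA card_mono[of "E `` {a}" "E `` {a} \<inter> B"] by simp
    qed
    finally have "m * s \<le> m * (r + (m - 1))"
      by (simp add: mA distrib_left)
    then show ?thesis
      using m by simp
  qed
  ultimately show ?thesis
    using that card_V by (simp add: V_def)
qed

section \<open>Regular graphs from residues\<close>

lemma card_add_mod_mem:
  fixes m c :: nat
  assumes "S \<subseteq> {..<m}"
  shows "card {j \<in> {..<m}. (c + j) mod m \<in> S} = card S"
proof -
  define f where "f = (\<lambda>j. (c + j) mod m)"
  have inj: "inj_on f {..<m}"
  proof (rule inj_onI)
    fix i j assume "i \<in> {..<m}" "j \<in> {..<m}" "f i = f j"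
    then show "i = j"
      by (metis f_def cong_def cong_add_lcancel_nat lessThan_iff mod_less)
  qed
  have "f ` {..<m} \<subseteq> {..<m}"
    by (force simp: f_def)
  then have surj: "f ` {..<m} = {..<m}"
    using inj by (simp add: endo_inj_surj)
  have "f ` {j \<in> {..<m}. f j \<in> S} = S"
    using surj assms by (auto simp: image_iff)
  moreover have "inj_on f {j \<in> {..<m}. f j \<in> S}"
    using inj by (rule inj_on_subset) auto
  ultimately show ?thesis
    unfolding f_def using card_image by fastforce
qed

text \<open>
  These are the connection sets of circulant graphs. For odd k the middle residue, which is its own
  negative, supplies the unpaired element.
\<close>

lemma ex_symmetric_residues:
  fixes k m :: nat
  assumes "k < m" and "even (k * m)"
  obtains S where "S \<subseteq> {0<..<m}" and "card S = k" and "\<And>d. d \<in> S \<Longrightarrow> m - d \<in> S"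
proof (cases "even k")
  case True
  then obtain h where k: "k = 2 * h" by blast
  have "card ({0<..h} \<union> {m - h..<m}) = k"
    using assms(1) k by (subst card_Un_disjoint) auto
  then show ?thesis
    using assms(1) k by (intro that[of "{0<..h} \<union> {m - h..<m}"]) auto
next
  case False
  then obtain h where k: "k = 2 * h + 1" by (auto elim: oddE)
  obtain l where m: "m = 2 * l"
    using assms(2) False by auto
  have "card (insert l ({0<..h} \<union> {m - h..<m})) = Suc (card ({0<..h} \<union> {m - h..<m}))"
    using assms(1) k m by (subst card_insert_disjoint) auto
  also have "card ({0<..h} \<union> {m - h..<m}) = 2 * h"
    using assms(1) k m by (subst card_Un_disjoint) auto
  finally show ?thesis
    using assms(1) k m by (intro that[of "insert l ({0<..h} \<union> {m - h..<m})"]) auto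
qed

lemma ex_regular_relation:
  fixes k m :: nat
  assumes "k < m" and "even (k * m)"
  obtains R where "R \<subseteq> {..<m} \<times> {..<m}" and "sym R" and "irrefl R"
    and "\<And>i. i < m \<Longrightarrow> card (R `` {i}) = k"
proof -
  obtain S where S: "S \<subseteq> {0<..<m}" "card S = k" "\<And>d. d \<in> S \<Longrightarrow> m - d \<in> S"
    using ex_symmetric_residues[OF assms] by blast
  \<comment> \<open>The residue of j - i modulo m, written without a truncating subtraction.\<close>
  define R where "R = {(i, j). i < m \<and> j < m \<and> ((m - i) + j) mod m \<in> S}"
  have "sym R"
  proof (rule symI)
    fix i j assume "(i, j) \<in> R"
    then have ij: "i < m" "j < m" "((m - i) + j) mod m \<in> S"
      by (auto simp: R_def)
    moreover have "((m - j) + i) mod m = m - ((m - i) + j) mod m"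
    proof (cases i j rule: linorder_cases)
      case less
      then have "((m - i) + j) mod m = j - i"
        using ij by (simp add: mod_if)
      then show ?thesis using less ij by simp
    next
      case equal
      then show ?thesis using ij S(1) by auto
    next
      case greater
      then have "((m - j) + i) mod m = i - j"
        using ij by (simp add: mod_if)
      then show ?thesis using greater ij by simp
    qed
    ultimately show "(j, i) \<in> R"
      using S(3) by (simp add: R_def)
  qed
  moreover have "irrefl R"
    using S(1) by (auto simp: R_def irrefl_def)
  moreover have "card (R `` {i}) = k" if "i < m" for i
  proof -
    have "R `` {i} = {j \<in> {..<m}. ((m - i) + j) mod m \<in> S}"
      using that by (auto simp: R_def)
    moreover have "S \<subseteq> {..<m}"
      using S(1) by auto
    ultimately show ?thesis
      by (simp only: card_add_mod_mem S(2))
  qed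
  ultimately show ?thesis
    by (intro that[of R]) (auto simp: R_def)
qed

section \<open>Construction of babi-graphs of girth 3\<close>

lemma Int_nonempty_if_card:
  assumes "finite C" and "X \<subseteq> C" and "Y \<subseteq> C" and "card C < card X + card Y"
  shows "X \<inter> Y \<noteq> {}"
proof
  assume "X \<inter> Y = {}"
  then have "card X + card Y = card (X \<union> Y)"
    using assms(1-3) by (metis card_Un_disjoint finite_subset)
  also have "\<dots> \<le> card C"
    using assms(1-3) by (intro card_mono) auto
  finally show False
    using assms(4) by simp
qed

text \<open>
  The vertices below m form the half of degree p + t, the others the half of degree q + t. The
  triangle consists of two adjacent vertices i, j of the first half and a common neighbour: each
  of them has p of the m vertices in the first half as neighbours and t of the m vertices in the
  second, and in one of the halves this is too many for disjoint neighbourhoods.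
\<close>

lemma ex_babi_graph_of_regular_parts:
  fixes m p q t :: nat
  assumes "p < m" and "q < m" and "t \<le> m" and "even (p * m)" and "even (q * m)"
    and "p \<noteq> q" and "0 < p" and "m < 2 * p \<or> m < 2 * t"
  obtains G :: "nat pair_pre_digraph"
  where "babi_graph (q + t) (p + t) 3 G" and "card (pverts G) = 2 * m"
proof -
  obtain P where P: "P \<subseteq> {..<m} \<times> {..<m}" "sym P" "irrefl P"
      "\<And>i. i < m \<Longrightarrow> card (P `` {i}) = p"
    using ex_regular_relation[OF assms(1,4)] by blast
  obtain Q where Q: "Q \<subseteq> {..<m} \<times> {..<m}" "sym Q" "irrefl Q"
      "\<And>i. i < m \<Longrightarrow> card (Q `` {i}) = q"
    using ex_regular_relation[OF assms(2,5)] by blast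
  \<comment> \<open>Joining i to j when the residue of i + j is small is t-regular on both sides at once, because
    the condition is symmetric in i and j.\<close>
  define N where "N = (\<lambda>i. {j \<in> {..<m}. (i + j) mod m \<in> {..<t}})"
  have N: "N i \<subseteq> {..<m}" "card (N i) = t" for i
    using assms(3) card_add_mod_mem[of "{..<t}" m i] by (auto simp: N_def)
  have N_sym: "i \<in> N j \<longleftrightarrow> j \<in> N i" if "i < m" "j < m" for i j
    using that by (auto simp: N_def add.commute)
  define E where "E = P \<union> {(m + i, m + j) | i j. (i, j) \<in> Q} \<union>
    {(i, m + j) | i j. i < m \<and> j \<in> N i} \<union> {(m + j, i) | i j. i < m \<and> j \<in> N i}"
  define G where "G = \<lparr>pverts = {..<2 * m}, parcs = E\<rparr>"
  have "E \<subseteq> {..<2 * m} \<times> {..<2 * m}"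
    using P(1) Q(1) by (auto simp: E_def N_def)
  moreover from this have "finite E"
    by (rule finite_subset) auto
  moreover have "sym E"
    using P(2) Q(2) unfolding E_def by (intro symI) (auto dest: symD)
  moreover have "irrefl E"
    using P(3) Q(3) by (auto simp: E_def N_def irrefl_def)
  ultimately have G: "pair_graph G"
    by unfold_locales (auto simp: G_def symmetric_def irrefl_def)
  have nbs1: "E `` {i} = P `` {i} \<union> (+) m ` N i" if "i < m" for i
    using that Q(1) by (auto simp: E_def)
  have nbs2: "E `` {m + j} = (+) m ` (Q `` {j}) \<union> N j" if "j < m" for j
    using that P(1) N_sym by (auto simp: E_def N_def)
  have deg1: "degree G i = p + t" if "i < m" for i
  proof -
    have sub: "P `` {i} \<subseteq> {..<m}"
      using P(1) by auto
    have "card (P `` {i} \<union> (+) m ` N i) = p + t"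
      using that P(4) N[of i] sub finite_subset[OF sub] finite_subset[OF N(1)[of i]]
      by (subst card_Un_disjoint) (auto simp: card_image)
    then show ?thesis
      by (simp add: degree_eq_card_Image G_def nbs1[OF that])
  qed
  have deg2: "degree G (m + j) = q + t" if "j < m" for j
  proof -
    have sub: "Q `` {j} \<subseteq> {..<m}"
      using Q(1) by auto
    have "card ((+) m ` (Q `` {j}) \<union> N j) = q + t"
      using that Q(4) N[of j] finite_subset[OF sub] finite_subset[OF N(1)[of j]]
      by (subst card_Un_disjoint) (auto simp: card_image)
    then show ?thesis
      by (simp add: degree_eq_card_Image G_def nbs2[OF that])
  qed
  have verts: "pverts G = {..<m} \<union> (+) m ` {..<m}"
  proof -
    have "v \<in> (+) m ` {..<m}" if "v < 2 * m" "\<not> v < m" for v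
      using that by (intro image_eqI[of _ _ "v - m"]) auto
    then show ?thesis
      by (auto simp: G_def)
  qed
  have "degree G ` pverts G = {q + t, p + t}"
  proof -
    have "degree G ` pverts G =
        (\<lambda>i. degree G i) ` {..<m} \<union> (\<lambda>j. degree G (m + j)) ` {..<m}"
      by (simp add: verts image_Un image_image)
    also have "\<dots> = (\<lambda>_. p + t) ` {..<m} \<union> (\<lambda>_. q + t) ` {..<m}"
      by (intro arg_cong2[of _ _ _ _ "(\<union>)"] image_cong) (simp_all add: deg1 deg2)
    also have "\<dots> = {q + t, p + t}"
      using assms(1) by auto
    finally show ?thesis .
  qed
  moreover have "{v \<in> pverts G. degree G v = p + t} = {..<m}"
    using assms(6) by (auto simp: verts deg1 deg2)
  moreover have "{v \<in> pverts G. degree G v = q + t} = (+) m ` {..<m}"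
    using assms(6) by (auto simp: verts deg1 deg2)
  moreover have "girth G = 3"
  proof -
    have "card (P `` {0}) > 0"
      using P(4)[of 0] assms(1,7) by simp
    then obtain i where i: "(0, i) \<in> P"
      by (auto simp: card_gt_0_iff)
    then have im: "i < m" and m: "0 < m"
      using P(1) by auto
    have "\<exists>x. (0, x) \<in> E \<and> (i, x) \<in> E"
      using assms(8)
    proof
      assume "m < 2 * p"
      then have "P `` {0} \<inter> P `` {i} \<noteq> {}"
        using P(1) P(4)[OF m] P(4)[OF im] by (intro Int_nonempty_if_card[of "{..<m}"]) auto
      then show ?thesis
        by (auto simp: E_def)
    next
      assume "m < 2 * t"
      then have "N 0 \<inter> N i \<noteq> {}"
        using N by (intro Int_nonempty_if_card[of "{..<m}"]) auto
      then show ?thesis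
        using im m by (auto simp: E_def)
    qed
    then obtain x where "(0, x) \<in> E" "(i, x) \<in> E"
      by blast
    moreover have "(0, i) \<in> E"
      using i by (simp add: E_def)
    ultimately show ?thesis
      using girth_eq_3I[OF G, of 0 i x] by (simp add: G_def)
  qed
  ultimately have "babi_graph (q + t) (p + t) 3 G"
    using G by (simp add: babi_graph_def card_image numeral_eq_enat)
  moreover have "card (pverts G) = 2 * m"
    by (simp add: G_def)
  ultimately show ?thesis
    by (rule that)
qed

text \<open>
  The idea is to put as many edges as possible between the two halves. Only if m is odd does
  parity matter: then t, r and s must agree modulo 2, and min m r may have to be lowered by one.
  The assumption m < s or m < 2 r serves the triangle: the two numbers s - t and t have sum s, so
  one of them exceeds m / 2 if m < s; and if m < 2 r, then min m r exceeds m / 2. So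
  does m - 1 when it is the lowered value, because the odd number m is then at least 3.
\<close>

lemma ex_crossing_degree:
  fixes r s m :: nat
  assumes "2 \<le> r" and "r < s" and "s < 2 * m" and "s < r + m" and "even (m * (r + s))"
    and "m < s \<or> m < 2 * r"
  obtains t where "t \<le> m" and "t \<le> r" and "s - t < m"
    and "even ((s - t) * m)" and "even ((r - t) * m)" and "m < 2 * (s - t) \<or> m < 2 * t"
proof (cases "even m \<or> r \<le> m")
  case True
  have "even ((s - min m r) * m) \<and> even ((r - min m r) * m)"
  proof (cases "even m")
    case False
    then have "r \<le> m" "even (r + s)"
      using True assms(5) by auto
    then show ?thesis
      using assms(2) by (simp add: min_def even_diff_nat)
  qed simp
  moreover have "m < 2 * (s - min m r) \<or> m < 2 * min m r"
    using assms by (auto simp: min_def)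
  ultimately show ?thesis
    using assms by (intro that[of "min m r"]) auto
next
  case False
  then have rm: "m < r" "odd m" and "even (r + s)"
    using assms(5) by auto
  define t where "t = (if odd s then m else m - 1)"
  have "even (s - t)" "even (r - t)"
    using rm \<open>even (r + s)\<close> assms(2) by (auto simp: t_def)
  moreover have "s - t < m"
    using assms(2,3) rm by (auto simp: t_def)
  moreover have "m < 2 * t"
  proof -
    have "m \<noteq> 1" using assms(1-3) by auto
    then have "3 \<le> m" using rm(2) by presburger
    then show ?thesis by (auto simp: t_def diff_mult_distrib2)
  qed
  ultimately show ?thesis
    using rm by (intro that[of t]) (auto simp: t_def)
qed

section \<open>The minimum order\<close>

lemma n_bb_eqI:
  fixes r s m :: nat
  assumes "2 \<le> r" and "r < s" and "s < 2 * m" and "s < r + m" and "even (m * (r + s))"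
    and "m < s \<or> m < 2 * r"
    and least: "\<And>m'. s < 2 * m' \<Longrightarrow> s < r + m' \<Longrightarrow> even (m' * (r + s)) \<Longrightarrow> m \<le> m'"
  shows "n_bb r s 3 = enat (2 * m)"
proof (rule antisym)
  obtain t where t: "t \<le> m" "t \<le> r" "s - t < m" "even ((s - t) * m)" "even ((r - t) * m)"
      "m < 2 * (s - t) \<or> m < 2 * t"
    using ex_crossing_degree[OF assms(1-6)] by blast
  have "r - t < m" "s - t \<noteq> r - t" "0 < s - t"
    using t(2,3) assms(2) by auto
  then obtain G :: "nat pair_pre_digraph"
    where "babi_graph (r - t + t) (s - t + t) 3 G" "card (pverts G) = 2 * m"
    using ex_babi_graph_of_regular_parts[of "s - t" m "r - t" t] t by blast
  then show "n_bb r s 3 \<le> enat (2 * m)"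
    using t(2) assms(2) unfolding n_bb_def by (intro INF_lower2[of G]) auto
next
  show "enat (2 * m) \<le> n_bb r s 3"
    unfolding n_bb_def
  proof (rule INF_greatest)
    fix G :: "nat pair_pre_digraph" assume "G \<in> {G. babi_graph r s 3 G}"
    then obtain m' where "card (pverts G) = 2 * m'" "s < 2 * m'" "s < r + m'" "even (m' * (r + s))"
      using babi_graph_order[OF _ assms(2)] by blast
    then show "enat (2 * m) \<le> enat (card (pverts G))"
      using least by simp
  qed
qed

lemma less_half_iff: "(real s + 1) / 2 < real r \<longleftrightarrow> s + 1 < 2 * r"
proof -
  have "(real s + 1) / 2 < real r \<longleftrightarrow> real (s + 1) < real (2 * r)"
    by auto
  then show ?thesis
    by (simp only: of_nat_less_iff)
qed

theorem theorem4p1: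
  fixes r s :: nat
  assumes "2 \<le> r" and "r < s"
  shows
    "((real s + 1) / 2 \<ge> real r \<longrightarrow> n_bb r s 3 = enat (2 * (s - r + 1))) \<and>
     (real r > (real s + 1) / 2 \<longrightarrow>
        (s mod 4 = 3 \<or> s mod 4 = 1 \<and> odd r \<longrightarrow> n_bb r s 3 = enat (s + 1)) \<and>
        (s mod 4 = 2 \<or> s mod 4 = 0 \<and> even r \<longrightarrow> n_bb r s 3 = enat (s + 2)) \<and>
        (s mod 4 = 1 \<and> even r \<longrightarrow> n_bb r s 3 = enat (s + 3)) \<and>
        (s mod 4 = 0 \<and> odd r \<longrightarrow> n_bb r s 3 = enat (s + 4)))"
proof (intro conjI impI)
  assume "(real s + 1) / 2 \<ge> real r"
  then have "2 * r \<le> s + 1"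
    by (simp flip: less_half_iff not_less)
  moreover have "even ((s - r + 1) * (r + s))"
    using assms(2) by auto
  ultimately show "n_bb r s 3 = enat (2 * (s - r + 1))"
    using assms by (intro n_bb_eqI) auto
next
  assume "real r > (real s + 1) / 2" "s mod 4 = 3 \<or> s mod 4 = 1 \<and> odd r"
  then have r: "s + 1 < 2 * r" and s: "s mod 4 = 3 \<or> s mod 4 = 1 \<and> odd r"
    by (simp_all add: less_half_iff)
  have "even (s + 1)" using s by presburger
  then obtain m where m: "s + 1 = 2 * m" by blast
  have "even (m * (r + s))" using s m by (auto; presburger)
  then have "n_bb r s 3 = enat (2 * m)"
    using assms r m by (intro n_bb_eqI) auto
  then show "n_bb r s 3 = enat (s + 1)" by (simp only: m)
next
  assume "real r > (real s + 1) / 2" "s mod 4 = 2 \<or> s mod 4 = 0 \<and> even r"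
  then have r: "s + 1 < 2 * r" and s: "s mod 4 = 2 \<or> s mod 4 = 0 \<and> even r"
    by (simp_all add: less_half_iff)
  have "even (s + 2)" using s by presburger
  then obtain m where m: "s + 2 = 2 * m" by blast
  have "even (m * (r + s))" using s m by (auto; presburger)
  then have "n_bb r s 3 = enat (2 * m)"
    using assms r m by (intro n_bb_eqI) auto
  then show "n_bb r s 3 = enat (s + 2)" by (simp only: m)
next
  assume "real r > (real s + 1) / 2" "s mod 4 = 1 \<and> even r"
  then have r: "s + 1 < 2 * r" and s: "s mod 4 = 1" "even r"
    by (simp_all add: less_half_iff)
  have "even (s + 3)" using s by presburger
  then obtain m where m: "s + 3 = 2 * m" by blast
  have "even m" using s m by presburger
  have "odd (r + s)" using s by presburger
  have "m \<le> m'" if "s < 2 * m'" "even (m' * (r + s))" for m'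
  proof -
    have "even m'" using that(2) \<open>odd (r + s)\<close> by auto
    then show ?thesis using that(1) m \<open>even m\<close> by presburger
  qed
  then have "n_bb r s 3 = enat (2 * m)"
    using assms r m \<open>even m\<close> by (intro n_bb_eqI) auto
  then show "n_bb r s 3 = enat (s + 3)" by (simp only: m)
next
  assume "real r > (real s + 1) / 2" "s mod 4 = 0 \<and> odd r"
  then have r: "s + 1 < 2 * r" and s: "s mod 4 = 0" "odd r"
    by (simp_all add: less_half_iff)
  have "even (s + 4)" using s by presburger
  then obtain m where m: "s + 4 = 2 * m" by blast
  have "even m" using s m by presburger
  have "odd (r + s)" using s by presburger
  have "m \<le> m'" if "s < 2 * m'" "even (m' * (r + s))" for m'
  proof -
    have "even m'" using that(2) \<open>odd (r + s)\<close> by auto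
    then show ?thesis using that(1) m \<open>even m\<close> by presburger
  qed
  then have "n_bb r s 3 = enat (2 * m)"
    using assms r m \<open>even m\<close> by (intro n_bb_eqI) auto
  then show "n_bb r s 3 = enat (s + 4)" by (simp only: m)
qed

end
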